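(* For every integer $s\ge1$ and every complex $q$ with $|q|<1$, $$\sum_{\substack{n_s\ge\cdots\ge n_1\ge0\\ l_s\ge\cdots\ge l_1\ge0\\ k_s\ge\cdots\ge k_1\ge0}}\frac{q^{n_1^2+\cdots+n_s^2+l_1^2+\cdots+l_s^2+k_1^2+\cdots+k_s^2}}{(q;q)_{n_s-n_{s-1}}\cdots(q;q)_{n_2-n_1}\,(q;q)_{l_s-l_{s-1}}\cdots(q;q)_{l_2-l_1}\,(q;q)_{k_s-k_{s-1}}\cdots(q;q)_{k_2-k_1}}$$ $$\times\frac{(q;q)_{n_1+l_1+k_1}}{(q;q)_{n_1+l_1}(q;q)_{n_1+k_1}(q;q)_{l_1+k_1}(q;q)_{n_1}(q;q)_{l_1}(q;q)_{k_1}}=\frac{1}{(q;q)_\infty^2}\prod_{\substack{m\ge1\\ m\not\equiv0,\pm(3s+1)\ (\mathrm{mod}\ 6s+3)}}\frac{1}{1-q^m}.$$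
   Context: Notation: $(x;q)_n=\prod_{j=0}^{n-1}(1-xq^j)$ for integers $n\ge0$, and $(x;q)_\infty=\prod_{j\ge0}(1-xq^j)$. The sum is over integers $n_i,l_i,k_i$ ($1\le i\le s$); for $s=1$ the products of difference factors are empty (equal to 1). *)

theory Defs
  imports "HOL-Analysis.Analysis" "HOL-Number_Theory.Cong"
begin

definition qpoch :: "complex \<Rightarrow> complex \<Rightarrow> nat \<Rightarrow> complex" where
  "qpoch x q n = (\<Prod>j<n. 1 - x * q ^ j)"

definition qpoch_inf :: "complex \<Rightarrow> complex \<Rightarrow> complex" where
  "qpoch_inf x q = (\<Prod>j. 1 - x * q ^ j)"

(* The sequences (n_1, ..., n_s) with n_s >= ... >= n_1 >= 0, as extensional functions
   on {1..s}, so that each sequence occurs exactly once. *)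
definition index_chains :: "nat \<Rightarrow> (nat \<Rightarrow> nat) set" where
  "index_chains s = {n \<in> extensional {1..s}. mono_on {1..s} n}"

(* The subtraction does not truncate for n in index_chains s; the product is 1 for s = 1. *)
definition diff_prod :: "nat \<Rightarrow> complex \<Rightarrow> (nat \<Rightarrow> nat) \<Rightarrow> complex" where
  "diff_prod s q n = (\<Prod>i=1..<s. qpoch q q (n (i + 1) - n i))"

definition summand :: "nat \<Rightarrow> complex \<Rightarrow> (nat \<Rightarrow> nat) \<Rightarrow> (nat \<Rightarrow> nat) \<Rightarrow> (nat \<Rightarrow> nat) \<Rightarrow> complex" where
  "summand s q n l k =
     q ^ ((\<Sum>i=1..s. (n i)\<^sup>2) + (\<Sum>i=1..s. (l i)\<^sup>2) + (\<Sum>i=1..s. (k i)\<^sup>2))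
       / (diff_prod s q n * diff_prod s q l * diff_prod s q k)
     * (qpoch q q (n 1 + l 1 + k 1)
         / (qpoch q q (n 1 + l 1) * qpoch q q (n 1 + k 1) * qpoch q q (l 1 + k 1)
            * qpoch q q (n 1) * qpoch q q (l 1) * qpoch q q (k 1)))"

(* The m with m >= 1 and m not congruent to 0, 3s+1, -(3s+1) modulo 6s+3. *)
definition admissible :: "nat \<Rightarrow> nat set" where
  "admissible s = {m. m \<ge> 1 \<and>
     \<not> [int m = 0] (mod (6 * int s + 3)) \<and>
     \<not> [int m = 3 * int s + 1] (mod (6 * int s + 3)) \<and>
     \<not> [int m = - (3 * int s + 1)] (mod (6 * int s + 3))}"

definition admissible_prod :: "nat \<Rightarrow> complex \<Rightarrow> complex" where
  "admissible_prod s q = (\<Prod>m. if m \<in> admissible s then 1 / (1 - q ^ m) else 1)"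

(* The infinite products above converge for |q| < 1, so prodinf is their genuine value. *)

lemma convergent_qpoch_inf:
  fixes x q :: complex
  assumes "norm q < 1"
  shows "convergent_prod (\<lambda>j. 1 - x * q ^ j)"
proof -
  have "summable (\<lambda>j. norm x * norm q ^ j)"
    using assms by (intro summable_mult summable_geometric) simp
  then have "summable (\<lambda>j. norm ((1 - x * q ^ j) - 1))"
    by (simp add: norm_mult norm_power)
  then show ?thesis
    by (rule abs_convergent_prod_imp_convergent_prod[OF summable_imp_abs_convergent_prod])
qed

lemma convergent_admissible_prod:
  fixes q :: complex
  assumes "norm q < 1"
  shows "convergent_prod (\<lambda>m. if m \<in> admissible s then 1 / (1 - q ^ m) else 1)"
proof -
  define f where "f m = (if m \<in> admissible s then 1 / (1 - q ^ m) else 1)" for m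
  have bound: "norm (f m - 1) \<le> norm q ^ m / (1 - norm q)" for m
  proof (cases "m \<in> admissible s")
    case True
    then have "m \<ge> 1" by (simp add: admissible_def)
    then have "norm q ^ m \<le> norm q"
      using assms power_decreasing[of 1 m "norm q"] by simp
    moreover have "1 - norm q ^ m \<le> norm (1 - q ^ m)"
      using norm_triangle_ineq2[of 1 "q ^ m"] by (simp add: norm_power)
    ultimately have b: "1 - norm q \<le> norm (1 - q ^ m)" by linarith
    with assms have "norm (1 - q ^ m) > 0" by linarith
    then have "1 - q ^ m \<noteq> 0" by simp
    then have "f m - 1 = q ^ m / (1 - q ^ m)"
      using True by (simp add: f_def divide_diff_eq_iff)
    then have "norm (f m - 1) = norm q ^ m / norm (1 - q ^ m)"
      by (simp add: norm_divide norm_power)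
    also have "\<dots> \<le> norm q ^ m / (1 - norm q)"
      using b assms by (intro divide_left_mono mult_pos_pos) auto
    finally show ?thesis .
  qed (use assms in \<open>simp add: f_def\<close>)
  have "summable (\<lambda>m. norm q ^ m / (1 - norm q))"
    using assms by (intro summable_divide summable_geometric) simp
  then have "summable (\<lambda>m. norm (f m - 1))"
    by (rule summable_comparison_test'[where N = 0]) (simp add: bound)
  then have "convergent_prod f"
    by (rule abs_convergent_prod_imp_convergent_prod[OF summable_imp_abs_convergent_prod])
  then show ?thesis by (simp only: f_def[abs_def])
qed

end

theory Submission
  imports Defs
begin

text \<open>
  By a finite form of the q-Dixon sum, the last factor of the summand equals the sum over all
  integers j of (-1)^j q^(j(3j+1)/2) times the product, over x in (n_1, l_1, k_1), of the kernels
  1 / ((q;q)_(x-j) (q;q)_(x+j)). For fixed j the triple sum thus factors into three equal sums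
  over chains, and a limiting case of the q-Vandermonde sum, a Bailey lemma step, reproduces the
  kernel up to a factor q^(j^2) each time one index is summed out; so each of the three sums is
  q^(s j^2) / (q;q)_\<infinity>. What remains is the sum over j of (-1)^j q^(((6s+3)j^2+j)/2), which the
  Jacobi triple product evaluates.
\<close>

section \<open>q-binomial coefficients\<close>

text \<open>The exponent j(3j+1)/2 splits as j^2 + j(j+1)/2, and the two parts do different work in
  the q-Dixon sum. The part j^2 is the price of rewriting two kernels as a sum of single ones. The
  part j(j+1)/2, with the sign, makes the alternating sum of a single kernel vanish except at index
  0, because the product evaluating it contains a factor 1 - 1. So one finite triple product serves
  twice: at a degenerate point for the q-Dixon sum, and in the limit for the final evaluation. The
  analytic obstacle is that j runs over all integers while the chains are unbounded. It is met by a
  majorant for the chain terms that is uniform in j, together with the decay of q^(j^2). The three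
  chain sums contribute (q;q)_\<infinity> to the power -3. The theta series equals (q;q)_\<infinity>
  times the restricted product, which leaves the power -2 of the claim.\<close>

text \<open>Being 0 at negative arguments lets sums run over ranges larger than their support.\<close>

definition inv_qpoch :: "complex \<Rightarrow> int \<Rightarrow> complex" where
  "inv_qpoch q m = (if m < 0 then 0 else 1 / qpoch q q (nat m))"

definition qbinom :: "complex \<Rightarrow> nat \<Rightarrow> int \<Rightarrow> complex" where
  "qbinom q n k = qpoch q q n * inv_qpoch q k * inv_qpoch q (int n - k)"

lemma inv_qpoch_neg: "m < 0 \<Longrightarrow> inv_qpoch q m = 0"
  by (simp add: inv_qpoch_def)

lemma inv_qpoch_0: "inv_qpoch q 0 = 1"
  by (simp add: inv_qpoch_def qpoch_def)

lemma qpoch_Suc: "qpoch q q (Suc n) = qpoch q q n * (1 - q ^ Suc n)"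
  by (simp add: qpoch_def)

lemma qbinom_0: "qbinom q 0 k = (if k = 0 then 1 else 0)"
  by (auto simp: qbinom_def inv_qpoch_def qpoch_def)

lemma qbinom_eq_0: "k < 0 \<or> int n < k \<Longrightarrow> qbinom q n k = 0"
  by (auto simp: qbinom_def inv_qpoch_neg)

lemma qbinom_sym: "qbinom q n (int n - k) = qbinom q n k"
  by (simp add: qbinom_def)

locale q_disk =
  fixes q :: complex
  assumes q: "norm q < 1"
begin

lemma one_minus_power_nonzero: "1 - q ^ Suc n \<noteq> 0"
proof
  assume "1 - q ^ Suc n = 0"
  then have "norm q ^ Suc n = 1"
    by (metis eq_iff_diff_eq_0 norm_one norm_power)
  moreover have "norm q ^ Suc n \<le> norm q"
    using q power_decreasing[of 1 "Suc n" "norm q"] by simp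
  ultimately show False using q by linarith
qed

lemma qpoch_nonzero: "qpoch q q n \<noteq> 0"
  using one_minus_power_nonzero by (auto simp: qpoch_def)

text \<open>Valid for all integers: for m < 0 both sides are 0, and at m = 0 the factor
  \<open>1 - q ^ nat m\<close> vanishes. So the q-Pascal rule needs no separate treatment of k = 0
  and k = n + 1.\<close>

lemma inv_qpoch_diff_1: "inv_qpoch q (m - 1) = (1 - q ^ nat m) * inv_qpoch q m"
proof (cases "m \<le> 0")
  case True
  then show ?thesis by (auto simp: inv_qpoch_neg)
next
  case False
  then obtain n where n: "m = int (Suc n)"
    by (metis gr0_implies_Suc not_le zero_less_imp_eq_int)
  show ?thesis
    using one_minus_power_nonzero[of n] qpoch_nonzero[of n]
    unfolding n by (simp add: inv_qpoch_def qpoch_Suc nat_add_distrib del: power_Suc)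
qed

text \<open>A q-Pascal rule; up to common factors it says 1 - q^(n+1) = (1 - q^k) + q^k (1 -
  q^(n+1-k)).\<close>

lemma qbinom_Suc:
  assumes "0 \<le> k"
  shows "qbinom q (Suc n) k = qbinom q n (k - 1) + q ^ nat k * qbinom q n k"
proof (cases "k \<le> int n + 1")
  case True
  have "nat (int n + 1 - k) + nat k = Suc n" using True assms by linarith
  then have p: "q ^ nat (int n + 1 - k) * q ^ nat k = q ^ Suc n"
    by (metis power_add)
  have e: "int n - k = (int n + 1 - k) - 1" "int n - (k - 1) = int n + 1 - k"
    "int (Suc n) - k = int n + 1 - k"
    by auto
  show ?thesis
    unfolding qbinom_def e inv_qpoch_diff_1 qpoch_Suc p[symmetric] by (simp add: algebra_simps)
qed (auto simp: qbinom_eq_0)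

text \<open>The companion q-Pascal rule, from the first one by the symmetry k -> n + 1 - k.\<close>

lemma qbinom_Suc':
  assumes "k \<le> int n + 1"
  shows "qbinom q (Suc n) k = qbinom q n k + q ^ nat (int n + 1 - k) * qbinom q n (k - 1)"
proof -
  have "qbinom q (Suc n) (int (Suc n) - k) = qbinom q n (int n - k) + 
     q ^ nat (int n + 1 - k) * qbinom q n (int n - (k - 1))"
    using qbinom_Suc[of "int (Suc n) - k" n] assms by (simp add: algebra_simps)
  then show ?thesis by (simp only: qbinom_sym)
qed

text \<open>Induction on A by q-Pascal in the first coefficient: the two halves are instances of the
  hypothesis at C - 1 and at C, and q-Pascal for A + B reassembles them. Truncation by
  \<open>nat\<close> is harmless: for k \<le> A the exponent is negative only if k > C, where the
  second coefficient vanishes.\<close>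

lemma q_Vandermonde:
  "(\<Sum>k\<le>A. q ^ nat ((C - int k) * (int A - int k)) * qbinom q A (int k) * qbinom q B (C - int k))
     = qbinom q (A + B) C"
proof (induction A arbitrary: C)
  case 0
  then show ?case by (simp add: qbinom_0)
next
  case (Suc A)
  show ?case
  proof (cases "C < 0")
    case True
    then show ?thesis by (simp add: qbinom_eq_0)
  next
    case False
    define t where "t = (\<lambda>k. q ^ nat ((C - int k) * (int (Suc A) - int k)) * qbinom q B (C - int k))"
    have "(\<Sum>k\<le>Suc A. q ^ nat ((C - int k) * (int (Suc A) - int k)) * qbinom q (Suc A) (int k) * qbinom q B (C - int k))
      = (\<Sum>k\<le>Suc A. t k * qbinom q A (int k - 1)) + (\<Sum>k\<le>Suc A. t k * q ^ k * qbinom q A (int k))"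
      by (simp add: qbinom_Suc t_def sum.distrib[symmetric] algebra_simps del: sum.atMost_Suc)
    also have "(\<Sum>k\<le>Suc A. t k * qbinom q A (int k - 1)) = (\<Sum>k\<le>A. t (Suc k) * qbinom q A (int k))"
      unfolding sum.atMost_Suc_shift by (simp add: qbinom_eq_0)
    also have "\<dots> = qbinom q (A + B) (C - 1)"
      unfolding Suc.IH[of "C - 1", symmetric] 
      by (intro sum.cong) (auto simp: t_def algebra_simps)
    also have "(\<Sum>k\<le>Suc A. t k * q ^ k * qbinom q A (int k)) = (\<Sum>k\<le>A. t k * q ^ k * qbinom q A (int k))"
      by (simp add: qbinom_eq_0)
    \<comment> \<open>The exponents match because (C - k)(A + 1 - k) + k = C + (C - k)(A -
      k).\<close>
    also have "\<dots> = q ^ nat C * qbinom q (A + B) C"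
      unfolding Suc.IH[of "C", symmetric] sum_distrib_left
    proof (intro sum.cong refl)
      fix k assume "k \<in> {..A}"
      then have k: "k \<le> A" by simp
      show "t k * q ^ k * qbinom q A (int k) =
         q ^ nat C * (q ^ nat ((C - int k) * (int A - int k)) * qbinom q A (int k) * qbinom q B (C - int k))"
      proof (cases "int k \<le> C")
        case True
        have "0 \<le> (C - int k) * (int A - int k)" "0 \<le> (C - int k) * (int (Suc A) - int k)"
          using True k by auto
        then have "int (nat ((C - int k) * (int (Suc A) - int k)) + k) = 
          int (nat C + nat ((C - int k) * (int A - int k)))"
          using False by (simp only: nat_0_le of_nat_add) (simp add: algebra_simps)
        then have "q ^ nat ((C - int k) * (int (Suc A) - int k)) * q ^ k = 
          q ^ nat C * q ^ nat ((C - int k) * (int A - int k))"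
          by (metis of_nat_eq_iff power_add)
        then show ?thesis by (simp add: t_def)
      qed (simp add: t_def qbinom_eq_0)
    qed
    also have "qbinom q (A + B) (C - 1) + q ^ nat C * qbinom q (A + B) C = qbinom q (Suc A + B) C"
      using qbinom_Suc[of C "A + B"] False by simp
    finally show ?thesis .
  qed
qed

end

section \<open>The Bailey kernel and the finite identities\<close>

text \<open>The matrix 1/((q;q)_(n-r) (aq;q)_(n+r)) of Bailey pairs at a = 1, with n and r here
  called \<open>a\<close> and \<open>j\<close>.\<close>

definition bailey_kernel :: "complex \<Rightarrow> nat \<Rightarrow> int \<Rightarrow> complex" where
  "bailey_kernel q a j = inv_qpoch q (int a - j) * inv_qpoch q (int a + j)"

text \<open>Triangular numbers on all integers; \<open>nat\<close> loses nothing since j(j+1) \<ge>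
  0. Natural exponents keep bilateral series free of negative powers.\<close>

definition tri :: "int \<Rightarrow> nat" where
  "tri j = nat (j * (j + 1) div 2)"

definition parity_sign :: "int \<Rightarrow> complex" where
  "parity_sign j = (if even j then 1 else -1)"

lemma bailey_kernel_minus: "bailey_kernel q a (- j) = bailey_kernel q a j"
  by (simp add: bailey_kernel_def)

lemma bailey_kernel_abs: "bailey_kernel q a \<bar>j\<bar> = bailey_kernel q a j"
  by (simp add: abs_if bailey_kernel_minus)

lemma bailey_kernel_eq_0: "int a < \<bar>j\<bar> \<Longrightarrow> bailey_kernel q a j = 0"
  by (cases "0 \<le> j") (auto simp: bailey_kernel_def inv_qpoch_neg)

lemma of_nat_tri: "2 * int (tri j) = j * (j + 1)"
proof -
  have "0 \<le> j * (j + 1)"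
    by (cases "0 \<le> j") (auto simp: zero_le_mult_iff)
  moreover have "even (j * (j + 1))" by simp
  ultimately show ?thesis by (simp add: tri_def)
qed

lemma tri_rec: "int (tri j) = int (tri (j - 1)) + j"
proof -
  have "2 * int (tri j) = 2 * (int (tri (j - 1)) + j)"
    by (simp only: of_nat_tri distrib_left) algebra
  then show ?thesis by simp
qed

lemma tri_0: "tri 0 = 0"
  by (simp add: tri_def)

lemma parity_sign_minus: "parity_sign (- j) = parity_sign j"
  by (simp add: parity_sign_def)

lemma parity_sign_diff_1: "parity_sign (j - 1) = - parity_sign j"
  by (simp add: parity_sign_def)

context q_disk
begin

lemma inv_qpoch_of_nat: "inv_qpoch q (int n) = 1 / qpoch q q n"
  by (simp add: inv_qpoch_def)

lemma inv_qpoch_cancel: "qpoch q q n * inv_qpoch q (int n) = 1"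
  by (simp add: inv_qpoch_of_nat qpoch_nonzero)

text \<open>This is \<open>q_Vandermonde\<close> at A = b + c, B = a, C = b, read backwards through
  k = b - t, so that (b - k)(b + c - k) becomes t(t + c). The offset c will be 2|j| for a product of
  two kernels, and the third parameter in the q-Dixon sum.\<close>

lemma q_Vandermonde_inv:
  "(\<Sum>t\<le>b. q ^ (t * (t + c)) * (inv_qpoch q (int t) * inv_qpoch q (int a - int t)
       * inv_qpoch q (int b - int t) * inv_qpoch q (int (t + c))))
     = qpoch q q (a + b + c) * inv_qpoch q (int a) * inv_qpoch q (int (b + c))
       * inv_qpoch q (int b) * inv_qpoch q (int (a + c))"
  (is "sum ?f _ = ?r")
proof -
  let ?g = "\<lambda>k. q ^ nat ((int b - int k) * (int (b + c) - int k)) * qbinom q (b + c) (int k) * qbinom q a (int b - int k)"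
  have "qpoch q q (b + c) * qpoch q q a * (\<Sum>t\<le>b. ?f t) = (\<Sum>t\<le>b. ?g (b - t))"
    unfolding sum_distrib_left
  proof (intro sum.cong refl)
    fix t assume "t \<in> {..b}"
    then have t: "int (b - t) = int b - int t" by auto
    have e: "nat ((int b - int (b - t)) * (int (b + c) - int (b - t))) = t * (t + c)"
      unfolding t by (simp add: nat_mult_distrib nat_add_distrib)
    have e2: "int (b + c) - (int b - int t) = int (t + c)" "int b - (int b - int t) = int t" by auto
    show "qpoch q q (b + c) * qpoch q q a * ?f t = ?g (b - t)"
      unfolding e qbinom_def unfolding t e2 by (simp add: mult_ac)
  qed
  also have "\<dots> = (\<Sum>k\<le>b. ?g k)"
    using sum.atLeastAtMost_rev[of ?g 0 b] by (simp add: atLeast0AtMost)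
  also have "\<dots> = (\<Sum>k\<le>b + c. ?g k)"
    by (intro sum.mono_neutral_left) (auto simp: qbinom_eq_0)
  also have "\<dots> = qbinom q (b + c + a) (int b)"
    by (rule q_Vandermonde)
  finally have *: "qpoch q q (b + c) * qpoch q q a * sum ?f {..b} = qbinom q (b + c + a) (int b)" .
  have "sum ?f {..b} = inv_qpoch q (int (b + c)) * inv_qpoch q (int a) * (qpoch q q (b + c) * qpoch q q a * sum ?f {..b})"
    using inv_qpoch_cancel[of "b + c"] inv_qpoch_cancel[of "a"] by algebra
  also have "\<dots> = ?r"
    unfolding * qbinom_def by (simp add: add_ac mult_ac)
  finally show ?thesis .
qed

text \<open>This and the next lemma are the q-Vandermonde sum with two different choices of the power of q:
  they trade a product of two kernels for a sum of single ones.\<close>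

lemma bailey_kernel_mult:
  "(\<Sum>t\<le>b. q ^ t\<^sup>2 * inv_qpoch q (int a - int t) * inv_qpoch q (int b - int t) * bailey_kernel q t j)
     = q ^ nat (j\<^sup>2) * qpoch q q (a + b) * bailey_kernel q a j * bailey_kernel q b j"
proof (cases "nat \<bar>j\<bar> \<le> a \<and> nat \<bar>j\<bar> \<le> b")
  case False
  have "w * bailey_kernel q a j * bailey_kernel q b j = 0" for w
    using False by (auto simp: bailey_kernel_eq_0)
  \<comment> \<open>A nonzero term needs |j| \<le> t \<le> min a b, which this case
    excludes.\<close>
  moreover have "w * inv_qpoch q (int a - int t) * inv_qpoch q (int b - int t) * bailey_kernel q t j = 0" for t w
    using False by (auto simp: inv_qpoch_def bailey_kernel_eq_0)
  ultimately show ?thesis by (simp only: sum.neutral_const)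
next
  case True
  define i where "i = nat \<bar>j\<bar>"
  have i: "i \<le> a" "i \<le> b" using True by (auto simp: i_def)
  have bk: "bailey_kernel q t j = bailey_kernel q t (int i)" for t
    by (simp add: i_def bailey_kernel_abs)
  have j2: "nat (j\<^sup>2) = i\<^sup>2"
    by (simp add: i_def nat_power_eq[symmetric])
  let ?f = "\<lambda>t. q ^ t\<^sup>2 * inv_qpoch q (int a - int t) * inv_qpoch q (int b - int t) * bailey_kernel q t (int i)"
  have "(\<Sum>t\<le>b. ?f t) = (\<Sum>t\<in>{i..b}. ?f t)"
    by (intro sum.mono_neutral_right) (auto simp: bailey_kernel_eq_0)
  also have "\<dots> = (\<Sum>t\<le>b - i. ?f (i + t))"
    using i by (simp add: sum.atLeastAtMost_shift_0 atLeast0AtMost)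
  \<comment> \<open>Since (i + t)^2 = i^2 + t(t + 2i), this is the form of
    \<open>q_Vandermonde_inv\<close> for a - i, b - i and offset 2i.\<close>
  also have "\<dots> = q ^ i\<^sup>2 * (\<Sum>t\<le>b - i. q ^ (t * (t + 2 * i)) * (inv_qpoch q (int t) * inv_qpoch q (int (a - i) - int t)
       * inv_qpoch q (int (b - i) - int t) * inv_qpoch q (int (t + 2 * i))))"
    unfolding sum_distrib_left
  proof (intro sum.cong refl)
    fix t
    have "(i + t)\<^sup>2 = i\<^sup>2 + t * (t + 2 * i)" by algebra
    then show "?f (i + t) = q ^ i\<^sup>2 * (q ^ (t * (t + 2 * i)) * (inv_qpoch q (int t) * inv_qpoch q (int (a - i) - int t)
       * inv_qpoch q (int (b - i) - int t) * inv_qpoch q (int (t + 2 * i))))"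
      using i by (simp add: bailey_kernel_def of_nat_diff power_add algebra_simps)
  qed
  also have "\<dots> = q ^ i\<^sup>2 * qpoch q q (a + b) * bailey_kernel q a (int i) * bailey_kernel q b (int i)"
    unfolding q_Vandermonde_inv using i by (simp add: bailey_kernel_def of_nat_diff algebra_simps)
  finally show ?thesis unfolding bk j2 .
qed

lemma bailey_kernel_mult':
  "(\<Sum>t\<le>a. q ^ nat ((int a - int t) * (int b - int t)) * inv_qpoch q (int a - int t)
        * inv_qpoch q (int b - int t) * bailey_kernel q t j)
     = qpoch q q (a + b) * bailey_kernel q a j * bailey_kernel q b j"
proof (cases "nat \<bar>j\<bar> \<le> a \<and> nat \<bar>j\<bar> \<le> b")
  case False
  have "w * bailey_kernel q a j * bailey_kernel q b j = 0" for w
    using False by (auto simp: bailey_kernel_eq_0)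
  moreover have "w * inv_qpoch q (int a - int t) * inv_qpoch q (int b - int t) * bailey_kernel q t j = 0" for t w
    using False by (auto simp: inv_qpoch_def bailey_kernel_eq_0)
  ultimately show ?thesis by (simp only: sum.neutral_const)
next
  case True
  define i where "i = nat \<bar>j\<bar>"
  have i: "i \<le> a" "i \<le> b" using True by (auto simp: i_def)
  have bk: "bailey_kernel q t j = bailey_kernel q t (int i)" for t
    by (simp add: i_def bailey_kernel_abs)
  let ?f = "\<lambda>t. q ^ nat ((int a - int t) * (int b - int t)) * inv_qpoch q (int a - int t)
        * inv_qpoch q (int b - int t) * bailey_kernel q t (int i)"
  \<comment> \<open>These factors turn the four reciprocals of a term into two q-binomials, those of
    \<open>q_Vandermonde\<close> at A = a - i, B = b + i, C = b - i.\<close>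
  let ?P = "qpoch q q (a - i) * qpoch q q (b + i)"
  have "(\<Sum>t\<le>a. ?f t) = (\<Sum>t\<in>{i..a}. ?f t)"
    by (intro sum.mono_neutral_right) (auto simp: bailey_kernel_eq_0)
  also have "\<dots> = (\<Sum>t\<le>a - i. ?f (i + t))"
    using i by (simp add: sum.atLeastAtMost_shift_0 atLeast0AtMost)
  finally have "?P * (\<Sum>t\<le>a. ?f t) = ?P * \<dots>" by simp
  also have "\<dots> = (\<Sum>t\<le>a - i. q ^ nat ((int (b - i) - int t) * (int (a - i) - int t)) 
     * qbinom q (a - i) (int t) * qbinom q (b + i) (int (b - i) - int t))"
    unfolding sum_distrib_left using i
    by (intro sum.cong refl)
      (simp add: bailey_kernel_def qbinom_def of_nat_diff algebra_simps)
  also have "\<dots> = qbinom q (a - i + (b + i)) (int (b - i))"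
    by (rule q_Vandermonde)
  also have "\<dots> = qpoch q q (a + b) * inv_qpoch q (int b - int i) * inv_qpoch q (int a + int i)"
    using i by (simp add: qbinom_def of_nat_diff algebra_simps)
  finally have *: "?P * sum ?f {..a} = \<dots>" .
  have "sum ?f {..a} = inv_qpoch q (int (a - i)) * inv_qpoch q (int (b + i)) * (?P * sum ?f {..a})"
    using inv_qpoch_cancel[of "a - i"] inv_qpoch_cancel[of "b + i"] by algebra
  also have "\<dots> = qpoch q q (a + b) * bailey_kernel q a (int i) * bailey_kernel q b (int i)"
    unfolding * using i by (simp add: bailey_kernel_def of_nat_diff mult_ac)
  finally show ?thesis unfolding bk .
qed

section \<open>The finite Jacobi triple product\<close>

lemma finite_triple_product_swap:
  assumes "(\<Prod>i<M. 1 - x * q ^ i) * (\<Prod>i<N. 1 - y * q ^ i)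
     = (\<Sum>j\<in>{- int N..int M}. parity_sign j * x ^ tri j * y ^ tri (- j) * qbinom q (M + N) (int N + j))"
  shows "(\<Prod>i<N. 1 - y * q ^ i) * (\<Prod>i<M. 1 - x * q ^ i)
     = (\<Sum>j\<in>{- int M..int N}. parity_sign j * y ^ tri j * x ^ tri (- j) * qbinom q (N + M) (int M + j))"
proof -
  have "(\<Sum>j\<in>{- int N..int M}. parity_sign j * x ^ tri j * y ^ tri (- j) * qbinom q (M + N) (int N + j))
    = (\<Sum>j\<in>{- int M..int N}. parity_sign j * y ^ tri j * x ^ tri (- j) * qbinom q (N + M) (int M + j))"
  proof (rule sum.reindex_bij_witness[of _ uminus uminus])
    fix j
    show "parity_sign (- j) * y ^ tri (- j) * x ^ tri (- (- j)) * qbinom q (N + M) (int M + - j)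
      = parity_sign j * x ^ tri j * y ^ tri (- j) * qbinom q (M + N) (int N + j)"
      using qbinom_sym[of q "M + N" "int N + j"] by (simp add: parity_sign_minus add.commute)
  qed auto
  with assms show ?thesis by (simp add: mult.commute)
qed

text \<open>The factor 1 - x q^M adds to the series a copy of it moved by one index. By
  \<open>shift\<close> both copies carry the same powers of x and y up to a power of q, and
  \<open>qbinom_Suc'\<close> merges their coefficients.\<close>

lemma finite_triple_product_step:
  assumes xy: "x * y = q"
    and eq: "(\<Prod>i<M. 1 - x * q ^ i) * (\<Prod>i<N. 1 - y * q ^ i)
     = (\<Sum>j\<in>{- int N..int M}. parity_sign j * x ^ tri j * y ^ tri (- j) * qbinom q (M + N) (int N + j))"
  shows "(\<Prod>i<Suc M. 1 - x * q ^ i) * (\<Prod>i<N. 1 - y * q ^ i)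
     = (\<Sum>j\<in>{- int N..int (Suc M)}. parity_sign j * x ^ tri j * y ^ tri (- j) * qbinom q (Suc M + N) (int N + j))"
proof -
  define g where "g = (\<lambda>j. parity_sign j * x ^ tri j * y ^ tri (- j))"
  let ?B = "\<lambda>j. qbinom q (M + N) (int N + j)"
  \<comment> \<open>With q = xy everything is a power of x times a power of y, so the claim becomes
    two identities between natural exponents, both instances of \<open>tri_rec\<close>.\<close>
  have shift: "- x * q ^ M * g (j - 1) = q ^ nat (int M + 1 - j) * g j" if "j \<le> int M + 1" for j
  proof -
    have "int (1 + M + tri (j - 1)) = int (nat (int M + 1 - j) + tri j)"
      using that tri_rec[of j] by simp
    then have e1: "1 + M + tri (j - 1) = nat (int M + 1 - j) + tri j" 
      by (simp only: of_nat_eq_iff)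
    have "int (M + tri (1 - j)) = int (nat (int M + 1 - j) + tri (- j))"
      using that tri_rec[of "1 - j"] by simp
    then have e2: "M + tri (1 - j) = nat (int M + 1 - j) + tri (- j)" 
      by (simp only: of_nat_eq_iff)
    have "- x * q ^ M * g (j - 1) = parity_sign j * x ^ (1 + M + tri (j - 1)) * y ^ (M + tri (1 - j))"
      unfolding g_def xy[symmetric] by (simp add: power_add power_mult_distrib parity_sign_diff_1)
    also have "\<dots> = q ^ nat (int M + 1 - j) * g j"
      unfolding e1 e2 g_def xy[symmetric] by (simp add: power_add power_mult_distrib)
    finally show ?thesis .
  qed
  have "(\<Prod>i<Suc M. 1 - x * q ^ i) * (\<Prod>i<N. 1 - y * q ^ i) = (1 - x * q ^ M) * (\<Sum>j\<in>{- int N..int M}. g j * ?B j)"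
    using eq by (simp add: g_def mult_ac)
  also have "\<dots> = (\<Sum>j\<in>{- int N..int M}. g j * ?B j) + (\<Sum>j\<in>{- int N..int M}. - x * q ^ M * g j * ?B j)"
    by (simp add: left_diff_distrib sum_distrib_left sum_negf sum_subtractf mult.assoc)
  also have "(\<Sum>j\<in>{- int N..int M}. g j * ?B j) = (\<Sum>j\<in>{- int N..int (Suc M)}. g j * ?B j)"
    by (intro sum.mono_neutral_left) (auto simp: qbinom_eq_0)
  also have "(\<Sum>j\<in>{- int N..int M}. - x * q ^ M * g j * ?B j) 
      = (\<Sum>j\<in>{- int N + 1..int (Suc M)}. - x * q ^ M * g (j - 1) * ?B (j - 1))"
    by (rule sum.reindex_bij_witness[of _ "\<lambda>j. j - 1" "\<lambda>j. j + 1"]) auto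
  also have "\<dots> = (\<Sum>j\<in>{- int N..int (Suc M)}. - x * q ^ M * g (j - 1) * ?B (j - 1))"
    by (intro sum.mono_neutral_left) (auto simp: qbinom_eq_0)
  also have "(\<Sum>j\<in>{- int N..int (Suc M)}. g j * ?B j) + \<dots> = 
     (\<Sum>j\<in>{- int N..int (Suc M)}. g j * ?B j + - x * q ^ M * g (j - 1) * ?B (j - 1))"
    by (simp only: sum.distrib)
  also have "\<dots> = (\<Sum>j\<in>{- int N..int (Suc M)}. g j * qbinom q (Suc M + N) (int N + j))"
  proof (intro sum.cong refl)
    fix j assume "j \<in> {- int N..int (Suc M)}"
    then have j: "j \<le> int M + 1" by simp
    have "qbinom q (Suc M + N) (int N + j) = ?B j + q ^ nat (int M + 1 - j) * ?B (j - 1)"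
      using qbinom_Suc'[of "int N + j" "M + N"] j by (simp add: algebra_simps)
    then show "g j * ?B j + - x * q ^ M * g (j - 1) * ?B (j - 1) = g j * qbinom q (Suc M + N) (int N + j)"
      unfolding shift[OF j] by (simp add: algebra_simps)
  qed
  finally show ?thesis by (simp add: g_def)
qed

text \<open>In terms of x and y with xy = q, instead of z and q / z, no division occurs, and q = 0 is
  not exceptional.\<close>

lemma finite_triple_product:
  assumes "x * y = q"
  shows "(\<Prod>i<M. 1 - x * q ^ i) * (\<Prod>i<N. 1 - y * q ^ i)
     = (\<Sum>j\<in>{- int N..int M}. parity_sign j * x ^ tri j * y ^ tri (- j) * qbinom q (M + N) (int N + j))"
    (is "?P x y M N")
proof -
  have yx: "y * x = q" using assms by (simp add: mult.commute)
  \<comment> \<open>The step lemma enlarges only the first product. So the product in y is built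
    first, with x and y exchanged and the other product empty; the reflection j -> -j then turns
    this into the case M = 0.\<close>
  have "?P y x N 0" for N
  proof (induction N)
    case 0
    show ?case by (simp add: parity_sign_def tri_0 qbinom_0)
  next
    case (Suc N)
    show ?case by (rule finite_triple_product_step[OF yx Suc])
  qed
  then have base: "?P x y 0 N" by (rule finite_triple_product_swap)
  show ?thesis
  proof (induction M)
    case 0
    show ?case by (rule base)
  next
    case (Suc M)
    show ?case by (rule finite_triple_product_step[OF assms Suc])
  qed
qed

section \<open>Alternating sums over one, two and three kernels\<close>

lemma alternating_kernel_sum:
  assumes "t \<le> N"
  shows "(\<Sum>j\<in>{- int N..int N}. parity_sign j * q ^ tri j * bailey_kernel q t j) = (if t = 0 then 1 else 0)"
proof -
  have "(\<Sum>j\<in>{- int N..int N}. parity_sign j * q ^ tri j * bailey_kernel q t j) 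
      = (\<Sum>j\<in>{- int t..int t}. parity_sign j * q ^ tri j * bailey_kernel q t j)"
    using assms by (intro sum.mono_neutral_right) (auto simp: bailey_kernel_eq_0)
  also have "\<dots> = inv_qpoch q (int (t + t)) *
     (\<Sum>j\<in>{- int t..int t}. parity_sign j * q ^ tri j * 1 ^ tri (- j) * qbinom q (t + t) (int t + j))"
    unfolding sum_distrib_left
  proof (intro sum.cong refl)
    fix j
    have "qbinom q (t + t) (int t + j) = qpoch q q (t + t) * bailey_kernel q t j"
      by (simp add: qbinom_def bailey_kernel_def algebra_simps)
    then have "inv_qpoch q (int (t + t)) * (parity_sign j * q ^ tri j * 1 ^ tri (- j) * qbinom q (t + t) (int t + j))
        = parity_sign j * q ^ tri j * bailey_kernel q t j * (qpoch q q (t + t) * inv_qpoch q (int (t + t)))"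
      by (simp only: power_one mult_1_right mult_1_left mult_ac)
    then show "parity_sign j * q ^ tri j * bailey_kernel q t j = inv_qpoch q (int (t + t)) *
        (parity_sign j * q ^ tri j * 1 ^ tri (- j) * qbinom q (t + t) (int t + j))"
      by (simp only: inv_qpoch_cancel mult_1_right mult_1_left)
  qed
  \<comment> \<open>The triple product at x = q, y = 1: for t > 0 the factor i = 0 of the second
    product is 1 - 1.\<close>
  also have "\<dots> = inv_qpoch q (int (t + t)) * ((\<Prod>i<t. 1 - q * q ^ i) * (\<Prod>i<t. 1 - 1 * q ^ i))"
    by (subst finite_triple_product[of q 1]) auto
  also have "\<dots> = (if t = 0 then 1 else 0)"
    by (cases t) (simp_all add: inv_qpoch_0 prod.lessThan_Suc_shift del: prod.lessThan_Suc)
  finally show ?thesis .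
qed

text \<open>\<open>bailey_kernel_mult'\<close> replaces the two kernels by single ones with t \<le>
  a, and by \<open>alternating_kernel_sum\<close> only t = 0 survives. A range given by N, common to
  all t, lets the two sums be exchanged.\<close>

lemma two_kernel_sum:
  assumes "a \<le> N"
  shows "(\<Sum>j\<in>{- int N..int N}. parity_sign j * q ^ tri j * (bailey_kernel q a j * bailey_kernel q b j))
    = q ^ (a * b) * inv_qpoch q (int a) * inv_qpoch q (int b) * inv_qpoch q (int (a + b))"
    (is "?S = _")
proof -
  let ?w = "\<lambda>t. q ^ nat ((int a - int t) * (int b - int t)) * inv_qpoch q (int a - int t)
        * inv_qpoch q (int b - int t)"
  have "qpoch q q (a + b) * ?S 
     = (\<Sum>j\<in>{- int N..int N}. parity_sign j * q ^ tri j * (\<Sum>t\<le>a. ?w t * bailey_kernel q t j))"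
    unfolding bailey_kernel_mult' sum_distrib_left by (simp add: mult_ac)
  also have "\<dots> = (\<Sum>t\<le>a. ?w t * (\<Sum>j\<in>{- int N..int N}. parity_sign j * q ^ tri j * bailey_kernel q t j))"
    unfolding sum_distrib_left by (subst sum.swap) (simp add: mult_ac)
  also have "\<dots> = (\<Sum>t\<le>a. ?w t * (if t = 0 then 1 else 0))"
    using assms by (intro sum.cong refl) (simp add: alternating_kernel_sum)
  also have "\<dots> = ?w 0"
    by (subst sum.mono_neutral_right[of _ "{0}"]) auto
  also have "\<dots> = q ^ (a * b) * inv_qpoch q (int a) * inv_qpoch q (int b)"
    by (simp add: nat_mult_distrib)
  finally have "qpoch q q (a + b) * ?S = \<dots>" .
  moreover have "?S = inv_qpoch q (int (a + b)) * (qpoch q q (a + b) * ?S)"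
    using inv_qpoch_cancel[of "a + b"] by algebra
  ultimately show ?thesis by (simp add: mult_ac)
qed

text \<open>\<open>bailey_kernel_mult\<close> absorbs q^(j^2) and the kernels at a and b into single
  kernels at t, and \<open>two_kernel_sum\<close> carries out the sum over j. As q^(t^2) q^(tc) =
  q^(t(t+c)), the remaining sum over t is \<open>q_Vandermonde_inv\<close>.\<close>

lemma q_Dixon:
  assumes "b \<le> N"
  shows "(\<Sum>j\<in>{- int N..int N}. parity_sign j * q ^ (nat (j\<^sup>2) + tri j) * 
        (bailey_kernel q a j * bailey_kernel q b j * bailey_kernel q c j))
    = qpoch q q (a + b + c) / (qpoch q q (a + b) * qpoch q q (a + c) * qpoch q q (b + c)
          * qpoch q q a * qpoch q q b * qpoch q q c)"
    (is "?S = _")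
proof -
  let ?w = "\<lambda>t. q ^ t\<^sup>2 * inv_qpoch q (int a - int t) * inv_qpoch q (int b - int t)"
  have "qpoch q q (a + b) * ?S 
     = (\<Sum>j\<in>{- int N..int N}. parity_sign j * q ^ tri j * bailey_kernel q c j * (\<Sum>t\<le>b. ?w t * bailey_kernel q t j))"
    unfolding bailey_kernel_mult sum_distrib_left by (simp add: power_add mult_ac)
  also have "\<dots> = (\<Sum>t\<le>b. ?w t * (\<Sum>j\<in>{- int N..int N}. parity_sign j * q ^ tri j * (bailey_kernel q t j * bailey_kernel q c j)))"
    unfolding sum_distrib_left by (subst sum.swap) (simp add: mult_ac)
  also have "\<dots> = (\<Sum>t\<le>b. ?w t * (q ^ (t * c) * inv_qpoch q (int t) * inv_qpoch q (int c) * inv_qpoch q (int (t + c))))"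
    using assms by (intro sum.cong refl) (simp add: two_kernel_sum)
  also have "\<dots> = inv_qpoch q (int c) * (\<Sum>t\<le>b. q ^ (t * (t + c)) * (inv_qpoch q (int t) * inv_qpoch q (int a - int t)
       * inv_qpoch q (int b - int t) * inv_qpoch q (int (t + c))))"
    unfolding sum_distrib_left by (simp add: power_add distrib_left power2_eq_square mult_ac)
  finally have "qpoch q q (a + b) * ?S = inv_qpoch q (int c) * (qpoch q q (a + b + c) * inv_qpoch q (int a) 
       * inv_qpoch q (int (b + c)) * inv_qpoch q (int b) * inv_qpoch q (int (a + c)))"
    unfolding q_Vandermonde_inv .
  moreover have "?S = inv_qpoch q (int (a + b)) * (qpoch q q (a + b) * ?S)"
    using inv_qpoch_cancel[of "a + b"] by algebra
  ultimately have "?S = inv_qpoch q (int (a + b)) * (inv_qpoch q (int c) * (qpoch q q (a + b + c) * inv_qpoch q (int a) 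
       * inv_qpoch q (int (b + c)) * inv_qpoch q (int b) * inv_qpoch q (int (a + c))))" by simp
  also have "\<dots> = qpoch q q (a + b + c) / (qpoch q q (a + b) * qpoch q q (a + c) * qpoch q q (b + c)
          * qpoch q q a * qpoch q q b * qpoch q q c)"
    unfolding inv_qpoch_of_nat by (simp add: mult_ac)
  finally show ?thesis .
qed

end

section \<open>Passage to the limit\<close>

text \<open>Tannery's theorem for unordered sums: the majorant M makes the finite partial sums
  converge uniformly in n, so the limit in n and the limit over finite subsets may be
  exchanged.\<close>

lemma has_sum_dominated_limit:
  fixes f :: "nat \<Rightarrow> 'i \<Rightarrow> 'b :: banach"
  assumes lim: "\<And>i. i \<in> A \<Longrightarrow> (\<lambda>n. f n i) \<longlonglongrightarrow> g i"
    and bound: "\<And>n i. i \<in> A \<Longrightarrow> norm (f n i) \<le> M i"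
    and M: "M summable_on A"
    and sums: "\<And>n. (f n has_sum S n) A"
    and L: "S \<longlonglongrightarrow> L"
  shows "(g has_sum L) A"
proof -
  have "norm (g i) \<le> M i" if "i \<in> A" for i
    by (rule tendsto_upperbound[OF tendsto_norm[OF lim[OF that]]]) (use bound that in auto)
  then have "(\<lambda>i. norm (g i)) summable_on A"
    by (intro summable_on_comparison_test[OF M]) auto
  then obtain G where G: "(g has_sum G) A"
    using abs_summable_summable summable_on_def by blast
  have u: "uniform_limit UNIV (\<lambda>X n. \<Sum>i\<in>X. f n i) S (finite_subsets_at_top A)"
    by (rule Weierstrass_m_test_general'[OF bound sums M])
  have ev: "\<forall>\<^sub>F X in finite_subsets_at_top A. (\<lambda>n. sum (f n) X) \<longlonglongrightarrow> sum g X"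
    unfolding eventually_finite_subsets_at_top
    by (rule exI[of _ "{}"]) (auto intro!: tendsto_sum lim)
  have "S \<longlonglongrightarrow> G"
    by (rule swap_uniform_limit'[OF ev G[unfolded has_sum_def] u]) auto
  with L G show ?thesis
    using LIMSEQ_unique by blast
qed

lemma summable_on_int_power_abs:
  fixes \<rho> :: real
  assumes "0 \<le> \<rho>" "\<rho> < 1"
  shows "(\<lambda>j::int. \<rho> ^ nat \<bar>j\<bar>) summable_on UNIV"
proof -
  have geo: "(\<lambda>n::nat. \<rho> ^ n) summable_on UNIV"
    using assms by (intro norm_summable_imp_summable_on) (auto simp: norm_power)
  have "(\<lambda>j::int. \<rho> ^ nat \<bar>j\<bar>) summable_on range int"
    using geo by (subst summable_on_reindex) (auto simp: o_def)
  moreover have "(\<lambda>j::int. \<rho> ^ nat \<bar>j\<bar>) summable_on range (\<lambda>n. - int n)"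
    using geo by (subst summable_on_reindex) (auto simp: o_def inj_def)
  moreover have "(UNIV :: int set) = range int \<union> range (\<lambda>n. - int n)"
    by (auto simp: image_iff) (metis int_cases2)
  ultimately show ?thesis
    by (metis summable_on_union)
qed

lemma abs_le_power2_int: "\<bar>j\<bar> \<le> j\<^sup>2" for j :: int
proof (cases "j = 0")
  case False
  then have "\<bar>j\<bar> * 1 \<le> \<bar>j\<bar> * \<bar>j\<bar>"
    by (intro mult_left_mono) auto
  then show ?thesis by (simp add: power2_eq_square)
qed simp

lemma tri_add_tri_minus: "tri j + tri (- j) = nat (j\<^sup>2)"
proof -
  have "2 * int (tri j + tri (- j)) = 2 * j\<^sup>2"
    unfolding of_nat_add distrib_left of_nat_tri by algebra
  then show ?thesis by simp
qed

lemma norm_parity_sign: "norm (parity_sign j) = 1"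
  by (simp add: parity_sign_def)

context q_disk
begin

lemma qpoch_LIMSEQ: "(\<lambda>n. qpoch x q n) \<longlonglongrightarrow> qpoch_inf x q"
  unfolding qpoch_def qpoch_inf_def
  using convergent_prod_has_prod[OF convergent_qpoch_inf[OF q]] by (rule has_prod_imp_tendsto')

lemma qpoch_inf_nonzero: "qpoch_inf q q \<noteq> 0"
  unfolding qpoch_inf_def
  using prodinf_nonzero[OF convergent_qpoch_inf[OF q]] one_minus_power_nonzero by simp

lemma filterlim_nat_int_diff: "filterlim (\<lambda>n. nat (int n - k)) at_top sequentially"
  unfolding filterlim_at_top
proof
  fix Z
  show "\<forall>\<^sub>F n in sequentially. Z \<le> nat (int n - k)"
    using eventually_ge_at_top[of "Z + nat \<bar>k\<bar>"] by eventually_elim linarith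
qed

lemma inv_qpoch_LIMSEQ: "(\<lambda>n. inv_qpoch q (int n - k)) \<longlonglongrightarrow> 1 / qpoch_inf q q"
proof (rule Lim_transform_eventually)
  show "(\<lambda>n. 1 / qpoch q q (nat (int n - k))) \<longlonglongrightarrow> 1 / qpoch_inf q q"
    by (intro tendsto_intros filterlim_compose[OF qpoch_LIMSEQ filterlim_nat_int_diff] qpoch_inf_nonzero)
  show "\<forall>\<^sub>F n in sequentially. 1 / qpoch q q (nat (int n - k)) = inv_qpoch q (int n - k)"
    using eventually_ge_at_top[of "nat \<bar>k\<bar>"] by eventually_elim (simp add: inv_qpoch_def)
qed

text \<open>A convergent sequence is bounded. Uniformity in m is what later makes majorants
  independent of j.\<close>

lemma inv_qpoch_bounded:
  obtains K where "K \<ge> 1" "\<And>m. norm (inv_qpoch q m) \<le> K"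
proof -
  have "Bseq (\<lambda>n. inv_qpoch q (int n))"
    using inv_qpoch_LIMSEQ[of 0] by (intro convergent_imp_Bseq convergentI) simp
  then obtain K where K: "\<And>n. norm (inv_qpoch q (int n)) \<le> K"
    by (auto simp: Bseq_def)
  show ?thesis
  proof
    show "norm (inv_qpoch q m) \<le> max 1 K" for m
      using K[of "nat m"] by (cases "m < 0") (auto simp: inv_qpoch_neg)
  qed simp
qed

lemma bailey_kernel_LIMSEQ: "(\<lambda>n. bailey_kernel q n j) \<longlonglongrightarrow> 1 / (qpoch_inf q q)\<^sup>2"
proof -
  have "(\<lambda>n. inv_qpoch q (int n - j) * inv_qpoch q (int n - (- j))) \<longlonglongrightarrow> 1 / qpoch_inf q q * (1 / qpoch_inf q q)"
    by (intro tendsto_mult inv_qpoch_LIMSEQ)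
  then show ?thesis by (simp add: bailey_kernel_def power2_eq_square)
qed

text \<open>The limit of bailey_kernel_mult as a tends to infinity.\<close>

lemma bailey_step:
  "(\<Sum>t\<le>b. q ^ t\<^sup>2 * inv_qpoch q (int b - int t) * bailey_kernel q t j) = q ^ nat (j\<^sup>2) * bailey_kernel q b j"
proof -
  let ?i = "qpoch_inf q q"
  have "(\<lambda>a. \<Sum>t\<le>b. q ^ t\<^sup>2 * inv_qpoch q (int a - int t) * inv_qpoch q (int b - int t) * bailey_kernel q t j)
     \<longlonglongrightarrow> (\<Sum>t\<le>b. q ^ t\<^sup>2 * (1 / ?i) * inv_qpoch q (int b - int t) * bailey_kernel q t j)"
    by (intro tendsto_intros inv_qpoch_LIMSEQ)
  moreover have "(\<lambda>a. q ^ nat (j\<^sup>2) * qpoch q q (a + b) * bailey_kernel q a j * bailey_kernel q b j)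
     \<longlonglongrightarrow> q ^ nat (j\<^sup>2) * ?i * (1 / ?i\<^sup>2) * bailey_kernel q b j"
    by (intro tendsto_intros bailey_kernel_LIMSEQ LIMSEQ_ignore_initial_segment qpoch_LIMSEQ)
  ultimately have "(\<Sum>t\<le>b. q ^ t\<^sup>2 * (1 / ?i) * inv_qpoch q (int b - int t) * bailey_kernel q t j)
     = q ^ nat (j\<^sup>2) * ?i * (1 / ?i\<^sup>2) * bailey_kernel q b j"
    unfolding bailey_kernel_mult by (rule LIMSEQ_unique)
  then have "(1 / ?i) * (\<Sum>t\<le>b. q ^ t\<^sup>2 * inv_qpoch q (int b - int t) * bailey_kernel q t j)
      = (1 / ?i) * (q ^ nat (j\<^sup>2) * bailey_kernel q b j)"
    by (simp add: sum_distrib_left power2_eq_square qpoch_inf_nonzero mult_ac)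
  then show ?thesis
    using qpoch_inf_nonzero by simp
qed

lemma summable_on_norm_power_square: "(\<lambda>t::nat. norm q ^ t\<^sup>2) summable_on UNIV"
proof (rule summable_on_comparison_test)
  show "(\<lambda>t::nat. norm q ^ t) summable_on UNIV"
    using q by (intro norm_summable_imp_summable_on) (auto simp: norm_power)
  show "norm q ^ t\<^sup>2 \<le> norm q ^ t" for t
    using q by (intro power_decreasing) (auto simp: power2_eq_square)
qed auto

lemma bailey_step_infinite:
  "((\<lambda>t. q ^ t\<^sup>2 * bailey_kernel q t j) has_sum (q ^ nat (j\<^sup>2) / qpoch_inf q q)) UNIV"
proof -
  let ?i = "qpoch_inf q q"
  obtain K where K: "K \<ge> 1" "\<And>m. norm (inv_qpoch q m) \<le> K"
    using inv_qpoch_bounded by blast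
  \<comment> \<open>the limit of bailey_step as b tends to infinity\<close>
  have "((\<lambda>t. q ^ t\<^sup>2 * (1 / ?i) * bailey_kernel q t j) has_sum (q ^ nat (j\<^sup>2) * (1 / ?i\<^sup>2))) UNIV"
  proof (rule has_sum_dominated_limit)
    show "(\<lambda>b. q ^ t\<^sup>2 * inv_qpoch q (int b - int t) * bailey_kernel q t j) 
        \<longlonglongrightarrow> q ^ t\<^sup>2 * (1 / ?i) * bailey_kernel q t j" for t
      by (intro tendsto_intros inv_qpoch_LIMSEQ)
    show "norm (q ^ t\<^sup>2 * inv_qpoch q (int b - int t) * bailey_kernel q t j) \<le> norm q ^ t\<^sup>2 * (K * (K * K))" for b t
      unfolding bailey_kernel_def norm_mult norm_power mult.assoc
      using K by (intro mult_mono mult_nonneg_nonneg) auto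
    show "(\<lambda>t. norm q ^ t\<^sup>2 * (K * (K * K))) summable_on UNIV"
      by (intro summable_on_cmult_left summable_on_norm_power_square)
    show "((\<lambda>t. q ^ t\<^sup>2 * inv_qpoch q (int b - int t) * bailey_kernel q t j) has_sum 
        q ^ nat (j\<^sup>2) * bailey_kernel q b j) UNIV" for b
      by (rule has_sum_finite_neutralI[of "{..b}"]) (auto simp: bailey_step inv_qpoch_neg)
    show "(\<lambda>b. q ^ nat (j\<^sup>2) * bailey_kernel q b j) \<longlonglongrightarrow> q ^ nat (j\<^sup>2) * (1 / ?i\<^sup>2)"
      by (intro tendsto_intros bailey_kernel_LIMSEQ)
  qed
  from has_sum_cmult_right[OF this, of ?i] show ?thesis
    by (simp add: qpoch_inf_nonzero power2_eq_square)
qed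

text \<open>The termwise limit of \<open>finite_triple_product\<close> for M = N: with j fixed, the
  q-binomial tends to 1 / (q;q)_\<infinity>, a constant that is multiplied away at the end.\<close>

lemma triple_product:
  assumes xy: "x * y = q" and x: "norm x < 1" and y: "norm y < 1"
  shows "((\<lambda>j. parity_sign j * x ^ tri j * y ^ tri (- j)) has_sum
     (qpoch_inf q q * qpoch_inf x q * qpoch_inf y q)) UNIV"
proof -
  let ?i = "qpoch_inf q q"
  define \<rho> where "\<rho> = max (norm x) (norm y)"
  have \<rho>: "0 \<le> \<rho>" "\<rho> < 1" "norm x \<le> \<rho>" "norm y \<le> \<rho>" using x y by (auto simp: \<rho>_def le_max_iff_disj)
  obtain K where K: "K \<ge> 1" "\<And>m. norm (inv_qpoch q m) \<le> K"
    using inv_qpoch_bounded by blast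
  have "Bseq (qpoch q q)"
    using qpoch_LIMSEQ by (intro convergent_imp_Bseq convergentI)
  then obtain K' where K': "\<And>n. norm (qpoch q q n) \<le> K'" 
    by (auto simp: Bseq_def)
  then have "0 \<le> K'" using norm_ge_zero order_trans by blast
  have "((\<lambda>j. parity_sign j * x ^ tri j * y ^ tri (- j) * (?i * (1 / ?i) * (1 / ?i))) has_sum
     (qpoch_inf x q * qpoch_inf y q)) UNIV"
  proof (rule has_sum_dominated_limit)
    fix j :: int
    have "(\<lambda>N. inv_qpoch q (int N - (- j))) \<longlonglongrightarrow> 1 / ?i" "(\<lambda>N. inv_qpoch q (int N - j)) \<longlonglongrightarrow> 1 / ?i"
      by (rule inv_qpoch_LIMSEQ)+
    moreover have "(\<lambda>N. qpoch q q (N + N)) \<longlonglongrightarrow> ?i"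
      by (rule filterlim_compose[OF qpoch_LIMSEQ filterlim_subseq]) (auto simp: strict_mono_def)
    ultimately have "(\<lambda>N. qpoch q q (N + N) * inv_qpoch q (int N - (- j)) * inv_qpoch q (int N - j)) \<longlonglongrightarrow> (?i * (1 / ?i) * (1 / ?i))"
      by (intro tendsto_mult)
    then have "(\<lambda>N. qbinom q (N + N) (int N + j)) \<longlonglongrightarrow> (?i * (1 / ?i) * (1 / ?i))"
      by (simp add: qbinom_def)
    then show "(\<lambda>N. parity_sign j * x ^ tri j * y ^ tri (- j) * qbinom q (N + N) (int N + j)) \<longlonglongrightarrow>
        parity_sign j * x ^ tri j * y ^ tri (- j) * (?i * (1 / ?i) * (1 / ?i))"
      by (intro tendsto_mult tendsto_const)
  next
    fix N and j :: int
    \<comment> \<open>Since tri j + tri (-j) = j^2 \<ge> |j|, one base \<rho> dominating both |x|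
      and |y| yields a geometric majorant.\<close>
    have "norm x ^ tri j * norm y ^ tri (- j) \<le> \<rho> ^ tri j * \<rho> ^ tri (- j)"
      using \<rho> by (intro mult_mono power_mono) auto
    also have "\<dots> \<le> \<rho> ^ nat \<bar>j\<bar>"
      unfolding power_add[symmetric] tri_add_tri_minus using \<rho> abs_le_power2_int[of j]
      by (intro power_decreasing) auto
    finally have 1: "norm x ^ tri j * norm y ^ tri (- j) \<le> \<rho> ^ nat \<bar>j\<bar>" .
    have 2: "norm (qbinom q (N + N) (int N + j)) \<le> K' * K * K"
      unfolding qbinom_def norm_mult using K K' \<open>0 \<le> K'\<close> by (intro mult_mono mult_nonneg_nonneg) auto
    show "norm (parity_sign j * x ^ tri j * y ^ tri (- j) * qbinom q (N + N) (int N + j)) \<le> \<rho> ^ nat \<bar>j\<bar> * (K' * K * K)"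
      unfolding norm_mult[of _ "qbinom _ _ _"]
      using 1 2 \<rho> by (intro mult_mono) (auto simp: norm_mult norm_power norm_parity_sign)
  next
    show "(\<lambda>j. \<rho> ^ nat \<bar>j\<bar> * (K' * K * K)) summable_on UNIV"
      using \<rho> by (intro summable_on_cmult_left summable_on_int_power_abs)
  next
    fix N
    show "((\<lambda>j. parity_sign j * x ^ tri j * y ^ tri (- j) * qbinom q (N + N) (int N + j)) has_sum 
       qpoch x q N * qpoch y q N) UNIV"
      by (rule has_sum_finite_neutralI[of "{- int N..int N}"])
        (auto simp: qpoch_def finite_triple_product[OF xy] qbinom_eq_0)
  next
    show "(\<lambda>N. qpoch x q N * qpoch y q N) \<longlonglongrightarrow> qpoch_inf x q * qpoch_inf y q"
      by (intro tendsto_intros qpoch_LIMSEQ)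
  qed
  from has_sum_cmult_right[OF this, of ?i] show ?thesis
    by (simp add: qpoch_inf_nonzero mult_ac)
qed

end

section \<open>Sums over chains\<close>

text \<open>The fibres over the last entry: dropping the last entry m of a chain of length s + 1
  leaves an element of \<open>bounded_chains s m\<close>. They are finite, so fibre sums are
  ordinary sums.\<close>

definition bounded_chains :: "nat \<Rightarrow> nat \<Rightarrow> (nat \<Rightarrow> nat) set" where
  "bounded_chains s N = {n \<in> index_chains s. n s \<le> N}"

text \<open>The share of one sequence in \<open>summand\<close>; what remains there couples only the
  first entries.\<close>

definition chain_weight :: "nat \<Rightarrow> complex \<Rightarrow> (nat \<Rightarrow> nat) \<Rightarrow> complex" where
  "chain_weight s q n = q ^ (\<Sum>i=1..s. (n i)\<^sup>2) / diff_prod s q n"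

lemma index_chains_mono:
  "n \<in> index_chains s \<Longrightarrow> 1 \<le> i \<Longrightarrow> i \<le> j \<Longrightarrow> j \<le> s \<Longrightarrow> n i \<le> n j"
  by (auto simp: index_chains_def intro: mono_onD)

lemma index_chains_subset_PiE:
  assumes "F \<subseteq> index_chains s" "finite F"
  obtains N where "F \<subseteq> PiE {1..s} (\<lambda>_. {..<N})"
proof
  \<comment> \<open>Each entry is at most the last entry of its chain, hence at most the sum of all
    last entries over F.\<close>
  show "F \<subseteq> PiE {1..s} (\<lambda>_. {..<Suc (\<Sum>n\<in>F. n s)})"
  proof
    fix n assume n: "n \<in> F"
    have "n i \<le> (\<Sum>n\<in>F. n s)" if "i \<in> {1..s}" for i
      using index_chains_mono[of n s i s] member_le_sum[of n F "\<lambda>n. n s"] n that assms by fastforce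
    then show "n \<in> PiE {1..s} (\<lambda>_. {..<Suc (\<Sum>n\<in>F. n s)})"
      using n assms by (auto simp: index_chains_def PiE_iff le_imp_less_Suc)
  qed
qed

lemma finite_bounded_chains: "finite (bounded_chains s N)"
proof (rule finite_subset)
  show "bounded_chains s N \<subseteq> PiE {1..s} (\<lambda>_. {..N})"
  proof
    fix n assume n: "n \<in> bounded_chains s N"
    have "n i \<le> N" if "i \<in> {1..s}" for i
      using index_chains_mono[of n s i s] n that by (auto simp: bounded_chains_def)
    then show "n \<in> PiE {1..s} (\<lambda>_. {..N})"
      using n by (auto simp: bounded_chains_def index_chains_def PiE_iff)
  qed
qed (auto intro: finite_PiE)

text \<open>Splits off the last entry. The inverse has to restrict to {1..s}, since chains are
  extensional and the value at s + 1 must become \<open>undefined\<close> again.\<close>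

lemma bij_betw_index_chains_Suc:
  assumes "1 \<le> s"
  shows "bij_betw (\<lambda>(m, n). n(Suc s := m)) (Sigma UNIV (bounded_chains s)) (index_chains (Suc s))"
proof (rule bij_betwI[of _ _ _ "\<lambda>n. (n (Suc s), restrict n {1..s})"])
  show "(\<lambda>(m, n). n(Suc s := m)) \<in> Sigma UNIV (bounded_chains s) \<rightarrow> index_chains (Suc s)"
  proof clarify
    fix m n assume "n \<in> bounded_chains s m"
    then have n: "n \<in> index_chains s" "n s \<le> m" by (auto simp: bounded_chains_def)
    have "(n(Suc s := m)) i \<le> (n(Suc s := m)) j" if "i \<in> {1..Suc s}" "j \<in> {1..Suc s}" "i \<le> j" for i j
      using index_chains_mono[OF n(1), of i "if j = Suc s then s else j"] n(2) that
      by (auto split: if_splits)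
    moreover have "n(Suc s := m) \<in> extensional {1..Suc s}"
      using n(1) by (auto simp: index_chains_def extensional_def)
    ultimately show "n(Suc s := m) \<in> index_chains (Suc s)"
      by (auto simp: index_chains_def mono_on_def)
  qed
  show "(\<lambda>n. (n (Suc s), restrict n {1..s})) \<in> index_chains (Suc s) \<rightarrow> Sigma UNIV (bounded_chains s)"
    using assms by (auto simp: index_chains_def bounded_chains_def mono_on_def)
  show "(\<lambda>n. (n (Suc s), restrict n {1..s})) ((\<lambda>(m, n). n(Suc s := m)) p) = p"
    if "p \<in> Sigma UNIV (bounded_chains s)" for p
    using that by (auto simp: bounded_chains_def index_chains_def extensional_def restrict_def fun_eq_iff)
  show "(\<lambda>(m, n). n(Suc s := m)) (n (Suc s), restrict n {1..s}) = n" if "n \<in> index_chains (Suc s)" for n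
    using that by (auto simp: index_chains_def extensional_def fun_eq_iff)
qed

lemma bij_betw_bounded_chains_Suc:
  assumes "1 \<le> s"
  shows "bij_betw (\<lambda>(m, n). n(Suc s := m)) (Sigma {..N} (bounded_chains s)) (bounded_chains (Suc s) N)"
proof (rule bij_betw_subset[OF bij_betw_index_chains_Suc[OF assms]])
  have "n \<in> (\<lambda>(m, n). n(Suc s := m)) ` Sigma {..N} (bounded_chains s)" if n: "n \<in> bounded_chains (Suc s) N" for n
  proof -
    have "n \<in> (\<lambda>(m, n). n(Suc s := m)) ` Sigma UNIV (bounded_chains s)"
      using n bij_betw_index_chains_Suc[OF assms] by (auto simp: bounded_chains_def bij_betw_def)
    then show ?thesis using n by (force simp: bounded_chains_def)
  qed
  moreover have "(\<lambda>(m, n). n(Suc s := m)) p \<in> bounded_chains (Suc s) N" if "p \<in> Sigma {..N} (bounded_chains s)" for p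
    using that bij_betw_apply[OF bij_betw_index_chains_Suc[OF assms], of p]
    by (auto simp: bounded_chains_def)
  ultimately show "(\<lambda>(m, n). n(Suc s := m)) ` Sigma {..N} (bounded_chains s) = bounded_chains (Suc s) N"
    by blast
qed auto

lemma bij_betw_index_chains_1: "bij_betw (\<lambda>m. \<lambda>i\<in>{1..1}. m) UNIV (index_chains 1)"
  by (rule bij_betwI[of _ _ _ "\<lambda>n. n 1"])
    (auto simp: index_chains_def mono_on_def extensional_def restrict_def fun_eq_iff)

lemma bij_betw_bounded_chains_1: "bij_betw (\<lambda>m. \<lambda>i\<in>{1..1}. m) {..N} (bounded_chains 1 N)"
  by (rule bij_betwI[of _ _ _ "\<lambda>n. n 1"])
    (auto simp: bounded_chains_def index_chains_def mono_on_def extensional_def restrict_def fun_eq_iff)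

lemma chain_weight_1: "chain_weight 1 q n = q ^ (n 1)\<^sup>2"
  by (simp add: chain_weight_def diff_prod_def)

lemma chain_weight_Suc:
  assumes "1 \<le> s" "n \<in> bounded_chains s m"
  shows "chain_weight (Suc s) q (n(Suc s := m)) = q ^ m\<^sup>2 * chain_weight s q n * inv_qpoch q (int m - int (n s))"
proof -
  have "(\<Sum>i=1..Suc s. ((n(Suc s := m)) i)\<^sup>2) = (\<Sum>i=1..s. (n i)\<^sup>2) + m\<^sup>2"
  proof -
    have "(\<Sum>i=1..s. ((n(Suc s := m)) i)\<^sup>2) = (\<Sum>i=1..s. (n i)\<^sup>2)"
      by (intro sum.cong) auto
    then show ?thesis by simp
  qed
  moreover have "diff_prod (Suc s) q (n(Suc s := m)) = diff_prod s q n * qpoch q q (m - n s)"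
    using assms(1) by (simp add: diff_prod_def prod.atLeastLessThan_Suc)
  moreover have "n s \<le> m" using assms by (simp add: bounded_chains_def)
  ultimately show ?thesis
    by (simp add: chain_weight_def power_add inv_qpoch_def nat_diff_distrib mult_ac)
qed

context q_disk
begin

text \<open>The factor \<open>inv_qpoch q (int N - int (n s))\<close> is the one that a further
  entry N would bring in. With it the induction closes: the hypothesis at the last entry m turns the
  inner sum into a kernel at m, and \<open>bailey_step\<close> sums over m, gaining another
  q^(j^2).\<close>

lemma bounded_chain_sum:
  assumes "1 \<le> s"
  shows "(\<Sum>n\<in>bounded_chains s N. chain_weight s q n * bailey_kernel q (n 1) j * inv_qpoch q (int N - int (n s)))
     = q ^ (s * nat (j\<^sup>2)) * bailey_kernel q N j"
  using assms
proof (induction s arbitrary: N rule: nat_induct_at_least)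
  case base
  have "(\<Sum>n\<in>bounded_chains 1 N. chain_weight 1 q n * bailey_kernel q (n 1) j * inv_qpoch q (int N - int (n 1)))
     = (\<Sum>m\<le>N. q ^ m\<^sup>2 * inv_qpoch q (int N - int m) * bailey_kernel q m j)"
    by (subst sum.reindex_bij_betw[OF bij_betw_bounded_chains_1, symmetric]) (simp add: chain_weight_1[simplified] mult_ac)
  also have "\<dots> = q ^ (1 * nat (j\<^sup>2)) * bailey_kernel q N j"
    by (simp add: bailey_step)
  finally show ?case .
next
  case (Suc s)
  let ?S = "Suc s"
  have "(\<Sum>n\<in>bounded_chains ?S N. chain_weight ?S q n * bailey_kernel q (n 1) j * inv_qpoch q (int N - int (n ?S)))
     = (\<Sum>(m, n)\<in>Sigma {..N} (bounded_chains s). q ^ m\<^sup>2 * inv_qpoch q (int N - int m) *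
          (chain_weight s q n * bailey_kernel q (n 1) j * inv_qpoch q (int m - int (n s))))"
    using Suc.hyps
    by (subst sum.reindex_bij_betw[OF bij_betw_bounded_chains_Suc[OF Suc.hyps], symmetric], intro sum.cong)
      (auto simp: chain_weight_Suc mult_ac)
  also have "\<dots> = (\<Sum>m\<le>N. q ^ m\<^sup>2 * inv_qpoch q (int N - int m) *
     (\<Sum>n\<in>bounded_chains s m. chain_weight s q n * bailey_kernel q (n 1) j * inv_qpoch q (int m - int (n s))))"
    by (subst sum.Sigma[symmetric]) (auto simp: finite_bounded_chains sum_distrib_left)
  also have "\<dots> = q ^ (s * nat (j\<^sup>2)) * (\<Sum>m\<le>N. q ^ m\<^sup>2 * inv_qpoch q (int N - int m) * bailey_kernel q m j)"
    unfolding Suc.IH sum_distrib_left by (simp add: mult_ac)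
  also have "\<dots> = q ^ (Suc s * nat (j\<^sup>2)) * bailey_kernel q N j"
    unfolding bailey_step by (simp add: power_add mult_ac)
  finally show ?case .
qed

text \<open>That B does not depend on j permits exchanging the sum over j with the sums over chains.
  Each reciprocal is at most K (s - 1 of them in the weight, two in the kernel), and the product of
  the |q|^(n_i^2) is summable.\<close>

lemma chain_weight_bound:
  obtains B where "B summable_on index_chains s"
    "\<And>n. n \<in> index_chains s \<Longrightarrow> 0 \<le> B n"
    "\<And>n j. n \<in> index_chains s \<Longrightarrow> norm (chain_weight s q n * bailey_kernel q (n 1) j) \<le> B n"
proof -
  obtain K where K: "K \<ge> 1" "\<And>m. norm (inv_qpoch q m) \<le> K"
    using inv_qpoch_bounded by blast
  define h where "h = (\<lambda>n :: nat \<Rightarrow> nat. \<Prod>i=1..s. norm q ^ (n i)\<^sup>2)"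
  define C where "C = (\<Sum>\<^sub>\<infinity>t. norm q ^ t\<^sup>2)"
  have h0: "0 \<le> h n" for n by (auto simp: h_def intro: prod_nonneg)
  have "h summable_on index_chains s"
  proof (rule nonneg_bdd_above_summable_on[OF h0], rule bdd_aboveI2)
    fix F assume "F \<in> {F. F \<subseteq> index_chains s \<and> finite F}"
    then have F: "F \<subseteq> index_chains s" "finite F" by auto
    then obtain N where N: "F \<subseteq> PiE {1..s} (\<lambda>_. {..<N})"
      using index_chains_subset_PiE by blast
    \<comment> \<open>Monotonicity of the chains is given up here: over a full box the sum factors
      into s one-variable sums, each at most C.\<close>
    have "sum h F \<le> sum h (PiE {1..s} (\<lambda>_. {..<N}))"
      using N h0 by (intro sum_mono2 finite_PiE) auto
    also have "\<dots> = (\<Prod>i=1..s. \<Sum>t<N. norm q ^ t\<^sup>2)"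
      unfolding h_def by (subst prod_sum_PiE) auto
    also have "\<dots> \<le> (\<Prod>i=1..s. C)"
      unfolding C_def
      by (intro prod_mono conjI sum_nonneg finite_sum_le_infsum summable_on_norm_power_square) auto
    finally show "sum h F \<le> (\<Prod>i=1..s. C)" .
  qed
  then have "(\<lambda>n. h n * (K ^ (s - 1) * (K * K))) summable_on index_chains s"
    by (rule summable_on_cmult_left)
  moreover have "norm (chain_weight s q n * bailey_kernel q (n 1) j) \<le> h n * (K ^ (s - 1) * (K * K))" for n j
  proof -
    have "norm (1 / diff_prod s q n) = (\<Prod>i=1..<s. norm (inv_qpoch q (int (n (i + 1) - n i))))"
      unfolding diff_prod_def inv_qpoch_of_nat norm_divide prod_norm[symmetric] by (simp add: prod_dividef)
    also have "\<dots> \<le> (\<Prod>i=1..<s. K)"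
      using K by (intro prod_mono) auto
    finally have 1: "norm (1 / diff_prod s q n) \<le> K ^ (s - 1)" by simp
    have 2: "norm (bailey_kernel q (n 1) j) \<le> K * K"
      unfolding bailey_kernel_def norm_mult using K by (intro mult_mono) auto
    have "norm (chain_weight s q n * bailey_kernel q (n 1) j) 
       = h n * (norm (1 / diff_prod s q n) * norm (bailey_kernel q (n 1) j))"
      by (simp add: chain_weight_def h_def power_sum norm_mult norm_divide norm_power prod_norm[symmetric])
    also have "\<dots> \<le> h n * (K ^ (s - 1) * (K * K))"
      using 1 2 K h0 by (intro mult_left_mono mult_mono) auto
    finally show ?thesis .
  qed
  moreover have "0 \<le> h n * (K ^ (s - 1) * (K * K))" for n
    using h0 K by simp
  ultimately show ?thesis using that by blast
qed

text \<open>For s > 1 the finite fibre over the last entry is summed by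
  \<open>bounded_chain_sum\<close>; the unbounded sum over the last entry is then
  \<open>bailey_step_infinite\<close>, the source of the factor 1 / (q;q)_\<infinity>.\<close>

lemma chain_sum:
  assumes "1 \<le> s"
  shows "((\<lambda>n. chain_weight s q n * bailey_kernel q (n 1) j) has_sum (q ^ (s * nat (j\<^sup>2)) / qpoch_inf q q))
     (index_chains s)"
proof -
  consider "s = 1" | s' where "s = Suc s'" "1 \<le> s'"
    using assms by (metis One_nat_def Suc_le_D le_SucE Suc_le_mono le_antisym not_less_eq_eq)
  then show ?thesis
  proof cases
    case 1
    show ?thesis
      unfolding 1 by (subst has_sum_reindex_bij_betw[OF bij_betw_index_chains_1, symmetric])
        (use bailey_step_infinite[of j] in \<open>simp add: chain_weight_1[simplified]\<close>)
  next
    case (2 s')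
    let ?f = "\<lambda>n. chain_weight s q n * bailey_kernel q (n 1) j"
    let ?g = "\<lambda>(m, n). q ^ m\<^sup>2 * (chain_weight s' q n * bailey_kernel q (n 1) j * inv_qpoch q (int m - int (n s')))"
    let ?u = "\<lambda>(m, n). n(Suc s' := m)"
    have bij: "bij_betw ?u (Sigma UNIV (bounded_chains s')) (index_chains s)"
      unfolding 2(1) by (rule bij_betw_index_chains_Suc[OF 2(2)])
    have g: "?f (?u p) = ?g p" if "p \<in> Sigma UNIV (bounded_chains s')" for p
      using that 2 by (auto simp: chain_weight_Suc)
    \<comment> \<open>Summing fibre by fibre requires summability of the whole family
      beforehand.\<close>
    obtain B where B: "B summable_on index_chains s" "\<And>n. n \<in> index_chains s \<Longrightarrow> norm (?f n) \<le> B n"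
      using chain_weight_bound[of s] by metis
    have "(\<lambda>n. norm (?f n)) summable_on index_chains s"
      by (rule summable_on_comparison_test[OF B]) (simp_all only: norm_ge_zero)
    then have "?f summable_on index_chains s"
      by (rule abs_summable_summable)
    then have "(\<lambda>p. ?f (?u p)) summable_on Sigma UNIV (bounded_chains s')"
      by (rule iffD2[OF summable_on_reindex_bij_betw[OF bij]])
    then have sg: "?g summable_on Sigma UNIV (bounded_chains s')"
      by (subst (asm) summable_on_cong[OF g])
    have "(?g has_sum (q ^ (s' * nat (j\<^sup>2)) * (q ^ nat (j\<^sup>2) / qpoch_inf q q))) (Sigma UNIV (bounded_chains s'))"
    proof (rule has_sum_SigmaI[OF _ _ sg])
      show "((\<lambda>n. ?g (m, n)) has_sum (q ^ (s' * nat (j\<^sup>2)) * (q ^ m\<^sup>2 * bailey_kernel q m j))) (bounded_chains s' m)" for m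
        unfolding prod.case by (rule has_sum_finiteI[OF finite_bounded_chains])
          (simp only: sum_distrib_left[symmetric] bounded_chain_sum[OF 2(2)] mult.left_commute)
      show "((\<lambda>m. q ^ (s' * nat (j\<^sup>2)) * (q ^ m\<^sup>2 * bailey_kernel q m j)) has_sum 
          (q ^ (s' * nat (j\<^sup>2)) * (q ^ nat (j\<^sup>2) / qpoch_inf q q))) UNIV"
        by (intro has_sum_cmult_right bailey_step_infinite)
    qed
    then have "((\<lambda>p. ?f (?u p)) has_sum (q ^ (s' * nat (j\<^sup>2)) * (q ^ nat (j\<^sup>2) / qpoch_inf q q))) (Sigma UNIV (bounded_chains s'))"
      by (subst has_sum_cong[OF g])
    then have "(?f has_sum (q ^ (s' * nat (j\<^sup>2)) * (q ^ nat (j\<^sup>2) / qpoch_inf q q))) (index_chains s)"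
      by (rule iffD1[OF has_sum_reindex_bij_betw[OF bij]])
    then show ?thesis by (simp add: 2 power_add mult_ac)
  qed
qed

end

section \<open>The product side and the interchange of summation\<close>

text \<open>Products are indexed from 0, hence the shift by one. As -(3s+1) is 3s+2 modulo 6s+3, the
  three exceptions in block i are those with m + 1 of residue 0, 3s+2 and 3s+1, in this
  order.\<close>

lemma admissible_Suc_iff:
  assumes "m \<in> {i * (6 * s + 3)..<i * (6 * s + 3) + (6 * s + 3)}"
  shows "Suc m \<in> admissible s \<longleftrightarrow>
    m \<notin> {i * (6 * s + 3) + (6 * s + 2), i * (6 * s + 3) + (3 * s + 1), i * (6 * s + 3) + 3 * s}"
proof -
  define M where "M = 6 * int s + 3"
  obtain r where m: "m = i * (6 * s + 3) + r" and r: "r < 6 * s + 3"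
    using assms by (metis add_less_cancel_left atLeastLessThan_iff le_Suc_ex)
  have "int (Suc m) = int r + 1 + int i * M"
    by (simp add: m M_def)
  then have "int (Suc m) mod M = (int r + 1) mod M"
    by (simp only: mod_mult_self1)
  also have "\<dots> = (if r = 6 * s + 2 then 0 else int r + 1)"
  proof (cases "r = 6 * s + 2")
    case True
    then have "int r + 1 = M" by (simp add: M_def)
    with True show ?thesis by simp
  qed (use r in \<open>simp add: M_def\<close>)
  finally have 1: "int (Suc m) mod M = (if r = 6 * s + 2 then 0 else int r + 1)" .
  have 2: "(3 * int s + 1) mod M = 3 * int s + 1"
    by (simp add: M_def)
  have "- (3 * int s + 1) mod M = (3 * int s + 2 + (- 1) * M) mod M"
    by (simp add: M_def)
  also have "\<dots> = (3 * int s + 2) mod M"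
    by (rule mod_mult_self1)
  also have "\<dots> = 3 * int s + 2"
    by (simp add: M_def)
  finally have 3: "- (3 * int s + 1) mod M = 3 * int s + 2" .
  show ?thesis
    unfolding admissible_def mem_Collect_eq M_def[symmetric] cong_def 1 2 3 unfolding m by auto
qed

lemma summable_on_Times_mult:
  fixes f g :: "_ \<Rightarrow> real"
  assumes f: "f summable_on A" "\<And>x. x \<in> A \<Longrightarrow> 0 \<le> f x"
    and g: "g summable_on B" "\<And>y. y \<in> B \<Longrightarrow> 0 \<le> g y"
  shows "(\<lambda>(x, y). f x * g y) summable_on A \<times> B"
proof (rule summable_on_SigmaI)
  show "((\<lambda>y. (\<lambda>(x, y). f x * g y) (x, y)) has_sum f x * infsum g B) B" for x
    unfolding prod.case by (intro has_sum_cmult_right has_sum_infsum g)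
  show "(\<lambda>x. f x * infsum g B) summable_on A"
    by (intro summable_on_cmult_left f)
qed (use f g in auto)

lemma has_sum_Times_mult:
  fixes f g :: "_ \<Rightarrow> complex"
  assumes "(f has_sum a) A" "(g has_sum b) B" "(\<lambda>(x, y). f x * g y) summable_on A \<times> B"
  shows "((\<lambda>(x, y). f x * g y) has_sum (a * b)) (A \<times> B)"
  by (rule has_sum_SigmaI[OF _ _ assms(3)])
    (auto intro!: has_sum_cmult_right has_sum_cmult_left assms)

lemma summand_eq:
  "summand s q n l k = chain_weight s q n * chain_weight s q l * chain_weight s q k
     * (qpoch q q (n 1 + l 1 + k 1)
         / (qpoch q q (n 1 + l 1) * qpoch q q (n 1 + k 1) * qpoch q q (l 1 + k 1)
            * qpoch q q (n 1) * qpoch q q (l 1) * qpoch q q (k 1)))"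
  by (simp add: summand_def chain_weight_def power_add)

context q_disk
begin

text \<open>Each admissible factor cancels against one of (q;q)_\<infinity>. The surviving 1 - q^m,
  with m of residue 0, 3s+2 or 3s+1 modulo 6s+3, form three products with base q^(6s+3).\<close>

lemma admissible_prod_eq:
  "qpoch_inf q q * admissible_prod s q =
     qpoch_inf (q ^ (6 * s + 3)) (q ^ (6 * s + 3)) * qpoch_inf (q ^ (3 * s + 2)) (q ^ (6 * s + 3))
       * qpoch_inf (q ^ (3 * s + 1)) (q ^ (6 * s + 3))"
proof -
  define M where "M = 6 * s + 3"
  have M: "0 < M" by (simp add: M_def)
  define f where "f = (\<lambda>m. if m \<in> admissible s then 1 / (1 - q ^ m) else 1)"
  have "norm q ^ M \<le> norm q ^ 1"
    using q M by (intro power_decreasing) auto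
  then interpret Q: q_disk "q ^ M"
    using q by unfold_locales (simp add: norm_power)
  \<comment> \<open>Limits are taken along multiples of M, so that partial products consist of
    complete residue blocks.\<close>
  have sub: "filterlim (\<lambda>N. N * M) at_top sequentially"
    using M by (intro filterlim_subseq) (auto simp: strict_mono_def)
  have "f has_prod admissible_prod s q"
    unfolding f_def admissible_prod_def by (intro convergent_prod_has_prod convergent_admissible_prod q)
  then have "(\<lambda>K. \<Prod>m<K. f m) \<longlonglongrightarrow> admissible_prod s q"
    by (rule has_prod_imp_tendsto')
  then have "(\<lambda>K. \<Prod>m<Suc K. f m) \<longlonglongrightarrow> admissible_prod s q"
    by (rule LIMSEQ_Suc)
  \<comment> \<open>As 0 is not admissible, the first factor is 1; dropping it aligns the indexing
    with \<open>qpoch q q\<close>, whose factor at m is 1 - q^(m+1).\<close>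
  moreover have "(\<Prod>m<Suc K. f m) = (\<Prod>m<K. f (Suc m))" for K
    unfolding prod.lessThan_Suc_shift by (simp add: f_def admissible_def)
  ultimately have "(\<lambda>K. \<Prod>m<K. f (Suc m)) \<longlonglongrightarrow> admissible_prod s q"
    by simp
  then have "(\<lambda>N. \<Prod>m<N * M. f (Suc m)) \<longlonglongrightarrow> admissible_prod s q"
    by (rule filterlim_compose[OF _ sub])
  moreover have "(\<lambda>N. qpoch q q (N * M)) \<longlonglongrightarrow> qpoch_inf q q"
    by (rule filterlim_compose[OF qpoch_LIMSEQ sub])
  ultimately have lim1: "(\<lambda>N. qpoch q q (N * M) * (\<Prod>m<N * M. f (Suc m))) \<longlonglongrightarrow> qpoch_inf q q * admissible_prod s q"
    by (intro tendsto_mult)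
  have fin: "qpoch q q (N * M) * (\<Prod>m<N * M. f (Suc m)) =
     qpoch (q ^ M) (q ^ M) N * qpoch (q ^ (3 * s + 2)) (q ^ M) N * qpoch (q ^ (3 * s + 1)) (q ^ M) N" for N
  proof -
    define e where "e = (\<lambda>m. if Suc m \<in> admissible s then 1 else 1 - q ^ Suc m)"
    have "qpoch q q (N * M) * (\<Prod>m<N * M. f (Suc m)) = (\<Prod>m<N * M. e m)"
      unfolding qpoch_def prod.distrib[symmetric] e_def f_def
      by (intro prod.cong) (use one_minus_power_nonzero in auto)
    also have "\<dots> = (\<Prod>i<N. \<Prod>m\<in>{i * M..<i * M + M}. e m)"
      by (rule prod.nat_group[symmetric])
    also have "\<dots> = (\<Prod>i<N. (1 - q ^ M * (q ^ M) ^ i) * (1 - q ^ (3 * s + 2) * (q ^ M) ^ i) * (1 - q ^ (3 * s + 1) * (q ^ M) ^ i))"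
    proof (intro prod.cong refl)
      fix i
      let ?R = "{i * M + (6 * s + 2), i * M + (3 * s + 1), i * M + 3 * s}"
      have "(\<Prod>m\<in>{i * M..<i * M + M}. e m) = (\<Prod>m\<in>?R. e m)"
        using admissible_Suc_iff[of _ i s] by (intro prod.mono_neutral_right) (auto simp: e_def M_def)
      also have "\<dots> = (\<Prod>m\<in>?R. 1 - q ^ Suc m)"
      proof (intro prod.cong refl)
        fix m assume "m \<in> ?R"
        then show "e m = 1 - q ^ Suc m"
          using admissible_Suc_iff[of m i s] by (auto simp: e_def M_def)
      qed
      also have "\<dots> = (1 - q ^ Suc (i * M + (6 * s + 2))) * ((1 - q ^ Suc (i * M + (3 * s + 1))) * (1 - q ^ Suc (i * M + 3 * s)))"
        by simp
      finally have *: "(\<Prod>m\<in>{i * M..<i * M + M}. e m) = \<dots>" .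
      have "Suc (i * M + (6 * s + 2)) = M + M * i" "Suc (i * M + (3 * s + 1)) = (3 * s + 2) + M * i" 
        "Suc (i * M + 3 * s) = (3 * s + 1) + M * i"
        by (simp_all add: M_def)
      with * show "(\<Prod>m\<in>{i * M..<i * M + M}. e m) = 
         (1 - q ^ M * (q ^ M) ^ i) * (1 - q ^ (3 * s + 2) * (q ^ M) ^ i) * (1 - q ^ (3 * s + 1) * (q ^ M) ^ i)"
        by (simp only: power_add power_mult mult.assoc)
    qed
    finally show ?thesis by (simp only: qpoch_def prod.distrib)
  qed
  have "(\<lambda>N. qpoch (q ^ M) (q ^ M) N * qpoch (q ^ (3 * s + 2)) (q ^ M) N * qpoch (q ^ (3 * s + 1)) (q ^ M) N)
     \<longlonglongrightarrow> qpoch_inf (q ^ M) (q ^ M) * qpoch_inf (q ^ (3 * s + 2)) (q ^ M) * qpoch_inf (q ^ (3 * s + 1)) (q ^ M)"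
    by (intro tendsto_mult Q.qpoch_LIMSEQ)
  with lim1 have "qpoch_inf q q * admissible_prod s q = 
      qpoch_inf (q ^ M) (q ^ M) * qpoch_inf (q ^ (3 * s + 2)) (q ^ M) * qpoch_inf (q ^ (3 * s + 1)) (q ^ M)"
    unfolding fin by (rule LIMSEQ_unique)
  then show ?thesis unfolding M_def .
qed

text \<open>The cube comes from the three chain sums. By j^2 = tri j + tri (-j) the total exponent
  is (3s+2) tri j + (3s+1) tri (-j), so this is \<open>triple_product\<close> with base q^(6s+3), x
  = q^(3s+2) and y = q^(3s+1).\<close>

lemma theta_sum:
  "((\<lambda>j. parity_sign j * q ^ (nat (j\<^sup>2) + tri j) * (q ^ (s * nat (j\<^sup>2)))^3) has_sum
     (qpoch_inf q q * admissible_prod s q)) UNIV"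
proof -
  have small: "norm (q ^ k) < 1" if "1 \<le> k" for k
    using q that power_decreasing[of 1 k "norm q"] by (simp add: norm_power)
  interpret Q: q_disk "q ^ (6 * s + 3)"
    by unfold_locales (rule small, simp)
  have "parity_sign j * (q ^ (3 * s + 2)) ^ tri j * (q ^ (3 * s + 1)) ^ tri (- j)
      = parity_sign j * q ^ (nat (j\<^sup>2) + tri j) * (q ^ (s * nat (j\<^sup>2)))^3" for j
  proof -
    have "(3 * s + 2) * tri j + (3 * s + 1) * tri (- j) = nat (j\<^sup>2) + tri j + s * nat (j\<^sup>2) * 3"
      unfolding tri_add_tri_minus[symmetric] by (simp add: algebra_simps)
    then have "(q ^ (3 * s + 2)) ^ tri j * (q ^ (3 * s + 1)) ^ tri (- j) = q ^ (nat (j\<^sup>2) + tri j) * (q ^ (s * nat (j\<^sup>2)))^3"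
      unfolding power_mult[symmetric] power_add[symmetric] by (simp only:)
    then show ?thesis by (simp only: mult.assoc)
  qed
  moreover have "q ^ (3 * s + 2) * q ^ (3 * s + 1) = q ^ (6 * s + 3)"
    unfolding power_add[symmetric] by (rule arg_cong[of _ _ "power q"]) simp
  then have "((\<lambda>j. parity_sign j * (q ^ (3 * s + 2)) ^ tri j * (q ^ (3 * s + 1)) ^ tri (- j)) has_sum
     (qpoch_inf q q * admissible_prod s q)) UNIV"
    unfolding admissible_prod_eq by (intro Q.triple_product small) simp_all
  ultimately show ?thesis by (simp only:)
qed

text \<open>The family F over j and triples of chains is absolutely summable and is summed in both
  orders: chains first gives the theta series, j first gives \<open>summand\<close>.\<close>

lemma sum_over_triples:
  assumes "1 \<le> s"
  shows "((\<lambda>(n, l, k). summand s q n l k) has_sum (1 / (qpoch_inf q q)\<^sup>2 * admissible_prod s q))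
         (index_chains s \<times> index_chains s \<times> index_chains s)"
proof -
  let ?i = "qpoch_inf q q" and ?X = "index_chains s"
  define c where "c = (\<lambda>j. parity_sign j * q ^ (nat (j\<^sup>2) + tri j))"
  define g where "g = (\<lambda>j n. chain_weight s q n * bailey_kernel q (n 1) j)"
  define F where "F = (\<lambda>(j, p). c j * (\<lambda>(n, p). g j n * (\<lambda>(l, k). g j l * g j k) p) p)"
  obtain B where B: "B summable_on ?X" "\<And>n. n \<in> ?X \<Longrightarrow> 0 \<le> B n" "\<And>n j. n \<in> ?X \<Longrightarrow> norm (g j n) \<le> B n"
    unfolding g_def using chain_weight_bound by blast
  have B2: "(\<lambda>(l, k). B l * B k) summable_on ?X \<times> ?X"
    by (intro summable_on_Times_mult B)
  have B3: "(\<lambda>(n, p). B n * (\<lambda>(l, k). B l * B k) p) summable_on ?X \<times> ?X \<times> ?X"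
    by (intro summable_on_Times_mult B B2) (auto intro!: B(2) mult_nonneg_nonneg)
  have B4: "(\<lambda>(j::int, p). norm q ^ nat \<bar>j\<bar> * (\<lambda>(n, p). B n * (\<lambda>(l, k). B l * B k) p) p) summable_on UNIV \<times> ?X \<times> ?X \<times> ?X"
    using q by (intro summable_on_Times_mult B3 summable_on_int_power_abs) (auto intro!: B(2) mult_nonneg_nonneg)
  have c: "norm (c j) \<le> norm q ^ nat \<bar>j\<bar>" for j
    unfolding c_def norm_mult norm_parity_sign norm_power mult_1_left
    using q abs_le_power2_int[of j] by (intro power_decreasing) auto
  have g2: "norm (g j l * g j k) \<le> B l * B k" if "l \<in> ?X" "k \<in> ?X" for j l k
    unfolding norm_mult using that by (intro mult_mono B) auto
  have g3: "norm (g j n * (g j l * g j k)) \<le> B n * (B l * B k)" if "n \<in> ?X" "l \<in> ?X" "k \<in> ?X" for j n l k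
    unfolding norm_mult[of "g j n"] using that by (intro mult_mono B g2) auto
  have "norm (c j * (g j n * (g j l * g j k))) \<le> norm q ^ nat \<bar>j\<bar> * (B n * (B l * B k))" 
    if "n \<in> ?X" "l \<in> ?X" "k \<in> ?X" for j n l k
    unfolding norm_mult[of "c j"] using that by (intro mult_mono c g3) auto
  then have "(\<lambda>x. norm (F x)) summable_on UNIV \<times> ?X \<times> ?X \<times> ?X"
    by (intro summable_on_comparison_test[OF B4]) (auto simp: F_def)
  then have F: "F summable_on UNIV \<times> ?X \<times> ?X \<times> ?X"
    by (rule abs_summable_summable)
  have G2: "(\<lambda>(l, k). g j l * g j k) summable_on ?X \<times> ?X" for j
    by (rule abs_summable_summable, rule summable_on_comparison_test[OF B2]) (use g2 in auto)
  have G3: "(\<lambda>(n, p). g j n * (\<lambda>(l, k). g j l * g j k) p) summable_on ?X \<times> ?X \<times> ?X" for j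
    by (rule abs_summable_summable, rule summable_on_comparison_test[OF B3]) (use g3 in auto)
  let ?w = "\<lambda>j. q ^ (s * nat (j\<^sup>2)) / ?i"
  have g: "(g j has_sum ?w j) ?X" for j
    unfolding g_def by (rule chain_sum[OF assms])
  have "((\<lambda>j. 1 / ?i ^ 3 * (c j * (q ^ (s * nat (j\<^sup>2)))^3)) has_sum (1 / ?i ^ 3 * (?i * admissible_prod s q))) UNIV"
    unfolding c_def by (intro has_sum_cmult_right theta_sum)
  then have outer: "((\<lambda>j. c j * (?w j * (?w j * ?w j))) has_sum (1 / ?i\<^sup>2 * admissible_prod s q)) UNIV"
    using qpoch_inf_nonzero by (simp add: power3_eq_cube power2_eq_square mult_ac)
  have "(F has_sum (1 / ?i\<^sup>2 * admissible_prod s q)) (UNIV \<times> ?X \<times> ?X \<times> ?X)"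
  proof (rule has_sum_SigmaI[OF _ outer F])
    show "((\<lambda>p. F (j, p)) has_sum c j * (?w j * (?w j * ?w j))) (?X \<times> ?X \<times> ?X)" for j
      unfolding F_def prod.case by (intro has_sum_cmult_right has_sum_Times_mult g G2 G3)
  qed
  then have swapped: "((\<lambda>(p, j). F (j, p)) has_sum (1 / ?i\<^sup>2 * admissible_prod s q)) ((?X \<times> ?X \<times> ?X) \<times> UNIV)"
    by (simp only: has_sum_swap[of F])
  show ?thesis
  proof (rule has_sum_SigmaD[OF swapped])
    fix p assume "p \<in> ?X \<times> ?X \<times> ?X"
    obtain n l k where p: "p = (n, l, k)" by (cases p)
    let ?W = "chain_weight s q n * chain_weight s q l * chain_weight s q k"
    let ?D = "\<lambda>j. c j * (bailey_kernel q (n 1) j * bailey_kernel q (l 1) j * bailey_kernel q (k 1) j)"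
    \<comment> \<open>The kernel at \<open>l 1\<close> vanishes for |j| > \<open>l 1\<close>, so the
      bilateral sum is finite: it is \<open>q_Dixon\<close> with both b and N equal to
      \<open>l 1\<close>.\<close>
    have "(?D has_sum (\<Sum>j\<in>{- int (l 1)..int (l 1)}. ?D j)) UNIV"
      by (rule has_sum_finite_neutralI[of "{- int (l 1)..int (l 1)}"]) (auto simp: bailey_kernel_eq_0)
    from has_sum_cmult_right[OF this, of ?W]
    have "((\<lambda>j. ?W * ?D j) has_sum summand s q n l k) UNIV"
      unfolding summand_eq c_def q_Dixon[OF order_refl] .
    then show "((\<lambda>j. (\<lambda>(p, j). F (j, p)) (p, j)) has_sum (\<lambda>(n, l, k). summand s q n l k) p) UNIV"
      by (simp add: p F_def g_def mult_ac)
  qed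
qed

end

theorem mainTheorem19:
  fixes s :: nat and q :: complex
  assumes "s \<ge> 1" and "norm q < 1"
  shows "((\<lambda>(n, l, k). summand s q n l k) has_sum
           (1 / (qpoch_inf q q)\<^sup>2 * admissible_prod s q))
         (index_chains s \<times> index_chains s \<times> index_chains s)"
proof -
  interpret q_disk q
    by unfold_locales (rule assms(2))
  show ?thesis
    by (rule sum_over_triples[OF assms(1)])
qed

end
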